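(* Let $a_k=2^{-2k}\binom{2k}{k}$ for $k\in\mathbb{N}$, so that $G_{1/2}(x)=\sum_{k\ge0}a_kx^k=\frac{1}{\sqrt{1-x}}$. For all $t\in\mathbb{N}$, $$\mathsf{space}_{G_{1/2}}(t;2t)=t+1.$$
   Context: Indices start at $0$, $\mathbb{N}=\{0,1,2,\dots\}$. For a sequence $a$ (equivalently its generating function $G=\sum a_kx^k$), $T[a]$ is the lower-triangular Toeplitz matrix with $T_{i,j}=a_{i-j}$ for $i\ge j$ and $0$ otherwise. Streaming model: a streaming algorithm consists of a buffer size function $\beta:\{-1\}\cup\mathbb{N}\to\mathbb{N}$ with $\beta(-1)=1$ and maps $u^{(t)}:\mathbb{R}^{\beta(t-1)}\times\mathbb{R}\to\mathbb{R}^{\beta(t)}$, $m^{(t)}:\mathbb{R}^{\beta(t)}\to\mathbb{R}$. On input $z\in\mathbb{R}^{\mathbb{N}}$, $s^{(-1)}=0\in\mathbb{R}$, $s^{(t)}=u^{(t)}(s^{(t-1)},z_t)$, output at time $t$ is $m^{(t)}(s^{(t)})$. For each $t$ the map $(z_0,\dots,z_t)\mapsto s^{(t)}$ must be continuous (output maps need not be). The algorithm computes $M$ correctly up to time $\tau$ if $m^{(t)}(s^{(t)})=(Mz)_t$ for all $z$ and all $t\le\tau$. $\mathsf{space}_M(t;\tau)$ is the minimum $b$ such that some streaming algorithm computes $M$ correctly up to time $\tau$ with $\max_{t'\le t}\beta(t')\le b$. $\mathsf{space}_{G}(t;\tau)$ denotes $\mathsf{space}_{T[a]}(t;\tau)$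 where $a$ is the coefficient sequence of $G$. *)

theory Defs
  imports "HOL-Analysis.Analysis"
begin

text \<open>
  \<^term>\<open>Euclidean_space n\<close> represents \<open>\<real>\<^sup>n\<close> by the functions \<^typ>\<open>nat \<Rightarrow> real\<close> vanishing at all
  indices \<open>\<ge> n\<close>. Buffer sizes are indexed by \<^typ>\<open>int\<close> because the initial state lives at time
  \<open>-1\<close>; only the values at times \<open>\<ge> -1\<close> matter.
\<close>

primrec stream_state ::
  "(nat \<Rightarrow> (nat \<Rightarrow> real) \<Rightarrow> real \<Rightarrow> (nat \<Rightarrow> real)) \<Rightarrow> (nat \<Rightarrow> real) \<Rightarrow> nat \<Rightarrow> (nat \<Rightarrow> real)"
where
  "stream_state u z 0 = u 0 (\<lambda>_. 0) (z 0)"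
| "stream_state u z (Suc t) = u (Suc t) (stream_state u z t) (z (Suc t))"

text \<open>
  The state at time \<open>t\<close> depends only on \<open>z\<^sub>0, \<dots>, z\<^sub>t\<close>, so the last condition is continuity of
  \<open>(z\<^sub>0, \<dots>, z\<^sub>t) \<mapsto> s\<^sup>(\<^sup>t\<^sup>)\<close> on \<open>\<real>\<^sup>t\<^sup>+\<^sup>1\<close>. Output maps \<open>m t\<close> are unrestricted.
\<close>

definition streaming_algorithm ::
  "(int \<Rightarrow> nat) \<Rightarrow> (nat \<Rightarrow> (nat \<Rightarrow> real) \<Rightarrow> real \<Rightarrow> (nat \<Rightarrow> real)) \<Rightarrow> (nat \<Rightarrow> (nat \<Rightarrow> real) \<Rightarrow> real) \<Rightarrow> bool"
where
  "streaming_algorithm \<beta> u m \<longleftrightarrow>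
     \<beta> (-1) = 1 \<and>
     (\<forall>t. \<forall>s \<in> topspace (Euclidean_space (\<beta> (int t - 1))). \<forall>x.
        u t s x \<in> topspace (Euclidean_space (\<beta> (int t)))) \<and>
     (\<forall>t. continuous_map (Euclidean_space (Suc t)) (Euclidean_space (\<beta> (int t)))
        (\<lambda>z. stream_state u z t))"

definition mat_apply :: "(nat \<Rightarrow> nat \<Rightarrow> real) \<Rightarrow> (nat \<Rightarrow> real) \<Rightarrow> nat \<Rightarrow> real" where
  "mat_apply M z i = (\<Sum>j. M i j * z j)"

definition computes_up_to ::
  "(nat \<Rightarrow> (nat \<Rightarrow> real) \<Rightarrow> real \<Rightarrow> (nat \<Rightarrow> real)) \<Rightarrow> (nat \<Rightarrow> (nat \<Rightarrow> real) \<Rightarrow> real) \<Rightarrow>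
   (nat \<Rightarrow> nat \<Rightarrow> real) \<Rightarrow> nat \<Rightarrow> bool"
where
  "computes_up_to u m M \<tau> \<longleftrightarrow>
     (\<forall>z. \<forall>t\<le>\<tau>. m t (stream_state u z t) = mat_apply M z t)"

text \<open>The infimum in \<^typ>\<open>enat\<close> is the minimum, or \<open>\<infinity>\<close> if no algorithm exists.\<close>

definition space_mat :: "(nat \<Rightarrow> nat \<Rightarrow> real) \<Rightarrow> nat \<Rightarrow> nat \<Rightarrow> enat" where
  "space_mat M t \<tau> = Inf {enat b | b. \<exists>\<beta> u m.
     streaming_algorithm \<beta> u m \<and> computes_up_to u m M \<tau> \<and> Max (\<beta> ` {-1..int t}) \<le> b}"

definition toeplitz :: "(nat \<Rightarrow> real) \<Rightarrow> nat \<Rightarrow> nat \<Rightarrow> real" where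
  "toeplitz a i j = (if j \<le> i then a (i - j) else 0)"

definition space_gf :: "real fps \<Rightarrow> nat \<Rightarrow> nat \<Rightarrow> enat" where
  "space_gf G = space_mat (toeplitz (fps_nth G))"

definition G_half :: "real fps" where
  "G_half = Abs_fps (\<lambda>k. real (2 * k choose k) / 2 ^ (2 * k))"

lemma G_half_nth_gchoose: "fps_nth G_half k = (-1) ^ k * ((-1/2) gchoose k)"
proof (induction k)
  case 0
  show ?case by (simp add: G_half_def)
next
  case (Suc k)
  define B C D where "B = (2 * Suc k choose Suc k)" and "C = (Suc (2 * k) choose k)"
    and "D = (2 * k choose k)"
  have "Suc k * B = 2 * Suc k * C"
    using Suc_times_binomial_eq[of "Suc (2 * k)" k] unfolding B_def C_def
    by (simp add: mult.commute del: binomial_Suc_Suc)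
  then have "real (Suc k) * real B = real (Suc k) * (2 * real C)"
    by (metis (no_types) mult.assoc mult.left_commute of_nat_mult of_nat_numeral)
  then have B: "real B = 2 * real C"
    by (simp del: of_nat_Suc)
  have "Suc k * C = Suc (2 * k) * D"
    using Suc_times_binomial_eq[of "2 * k" k] binomial_symmetric[of k "Suc (2 * k)"]
    unfolding C_def D_def by (simp add: mult.commute Suc_diff_le del: binomial_Suc_Suc)
  then have "real (Suc k) * real C = real (Suc (2 * k)) * real D"
    by (metis (no_types) of_nat_mult)
  then have "real (Suc k) * (real B / 2 ^ (2 * Suc k)) = (real k + 1/2) * (real D / 2 ^ (2 * k))"
    unfolding B by (simp add: field_simps)
  then have "real (Suc k) * fps_nth G_half (Suc k) = (real k + 1/2) * fps_nth G_half k"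
    by (simp only: G_half_def fps_nth_Abs_fps B_def D_def)
  also have "\<dots> = real (Suc k) * ((-1) ^ Suc k * ((-1/2) gchoose Suc k))"
  proof -
    have "real (Suc k) * ((-1/2) gchoose Suc k) = (-1/2 - real k) * ((-1/2) gchoose k)"
      by (metis gbinomial_absorb_comp gbinomial_absorption)
    then have "(-1) ^ Suc k * (real (Suc k) * ((-1/2) gchoose Suc k)) =
        (real k + 1/2) * ((-1) ^ k * ((-1/2) gchoose k))"
      by (simp only: power_Suc) (simp add: left_diff_distrib distrib_right right_diff_distrib)
    then show ?thesis
      by (metis (no_types) Suc.IH mult.left_commute)
  qed
  finally show ?case
    by (metis (no_types) mult_cancel_left of_nat_eq_0_iff nat.distinct(2))
qed

lemma G_half_sums:
  assumes "\<bar>x\<bar> < 1"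
  shows "(\<lambda>k. fps_nth G_half k * x ^ k) sums (1 / sqrt (1 - x))"
proof -
  have "(1 - x) powr (-1/2) = 1 / sqrt (1 - x)"
    using assms powr_minus_divide[of "1 - x" "1/2"] by (simp add: powr_half_sqrt)
  moreover have "((-1/2) gchoose k) * (- x) ^ k = fps_nth G_half k * x ^ k" for k
    by (simp add: G_half_nth_gchoose power_minus[of x])
  ultimately show ?thesis
    using gen_binomial_real[of "- x" "-1/2"] assms by simp
qed

end

theory Submission
  imports Defs "HOL-Homology.Invariance_of_Domain"
begin

text \<open>
  Storing the whole input prefix gives the upper bound. Conversely, with fewer than \<open>t + 1\<close> cells
  at time \<open>t\<close> the state is a continuous map from \<open>\<real>\<^sup>t\<^sup>+\<^sup>1\<close> to a space of smaller dimension, so by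
  invariance of domain two distinct prefixes share a state. Continued with zeros, both produce the
  same outputs at times \<open>t, \<dots>, 2t\<close>, so their difference, read backwards, is in the kernel of the
  Hankel matrix \<open>(a\<^sub>i\<^sub>+\<^sub>j)\<^sub>i\<^sub>,\<^sub>j\<^sub>\<le>\<^sub>t\<close>. But \<open>\<pi> a\<^sub>k\<close> is the integral of \<open>(sin\<^sup>2 x)\<^sup>k\<close> over \<open>[0, \<pi>]\<close>, so
  this is a moment matrix of a measure with infinite support, hence positive definite.
\<close>

text \<open>Regard \<open>f\<close> as a self-map of the larger space. If it were injective,
  invariance of domain would make its image open, although coordinate \<open>n\<close> vanishes on
  the whole image.\<close>

lemma no_continuous_injection_Euclidean_space:
  assumes "n < m" and f: "continuous_map (Euclidean_space m) (Euclidean_space n) f"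
  shows "\<not> inj_on f (topspace (Euclidean_space m))"
proof
  let ?U = "topspace (Euclidean_space m)"
  assume inj: "inj_on f ?U"
  have img: "f x i = 0" if "x \<in> ?U" "n \<le> i" for x i
    using continuous_map_image_subset_topspace[OF f] that
    by (auto simp: topspace_Euclidean_space image_subset_iff)
  have "continuous_map (Euclidean_space m) (Euclidean_space m) f"
    using f img \<open>n < m\<close>
    by (auto simp: Euclidean_space_def continuous_map_in_subtopology)
  then have op: "openin (Euclidean_space m) (f ` ?U)"
    by (intro invariance_of_domain_Euclidean_space inj) (auto simp: subtopology_topspace)
  define p where "p = f (\<lambda>_. 0)"
  have 0: "(\<lambda>_. 0) \<in> ?U"
    by (simp add: topspace_Euclidean_space)
  have p: "p i = 0" if "n \<le> i" for i
    using img[OF 0 that] by (simp add: p_def)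
  \<comment> \<open>The line through \<open>p\<close> in direction \<open>n\<close>. It meets the
    image only at \<open>s = 0\<close>, so openness of the image would make \<open>{0}\<close> open
    in the reals.\<close>
  define h where "h = (\<lambda>(s::real) i. if i < m then (if i = n then s else p i) else 0)"
  have "continuous_map euclideanreal (Euclidean_space m) h"
    unfolding h_def continuous_map_componentwise_Euclidean_space by auto
  then have "open {s. h s \<in> f ` ?U}"
    using openin_continuous_map_preimage[OF _ op] by fastforce
  moreover have "{s. h s \<in> f ` ?U} = {0}"
  proof -
    have "s = 0" if "h s \<in> f ` ?U" for s
      using that img[of _ n] \<open>n < m\<close> by (auto simp: h_def dest!: fun_cong[of _ _ n])
    moreover have "h 0 = p"
      using p \<open>n < m\<close> by (auto simp: h_def)
    ultimately show ?thesis
      using 0 by (auto simp: p_def)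
  qed
  ultimately show False
    using not_open_singleton[of "0::real"] by simp
qed

text \<open>The coefficient ratio, cleared of denominators so that it matches the reduction formula
  for the integrals of \<open>sin x ^ (2 * k)\<close>.\<close>

lemma G_half_Suc:
  "2 * real (Suc k) * fps_nth G_half (Suc k) = (2 * real k + 1) * fps_nth G_half k"
proof -
  have "real (Suc k) * ((-1/2) gchoose Suc k) = (-1/2 - real k) * ((-1/2) gchoose k)"
    by (metis gbinomial_absorb_comp gbinomial_absorption)
  then have "(-1) ^ k * (2 * (real (Suc k) * ((-1/2) gchoose Suc k))) =
      (-1) ^ k * (2 * ((-1/2 - real k) * ((-1/2) gchoose k)))"
    by simp
  then show ?thesis
    by (simp add: G_half_nth_gchoose algebra_simps del: of_nat_Suc)
qed

lemma has_integral_sin_power_G_half: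
  "((\<lambda>x. ((sin x)\<^sup>2) ^ k) has_integral pi * fps_nth G_half k) {0..pi}"
proof (induction k)
  case 0
  show ?case
    using has_integral_const_real[of "1::real" 0 pi] by (simp add: G_half_def)
next
  case (Suc k)
  \<comment> \<open>\<open>?F\<close> vanishes at both 0 and pi, so integrating its derivative
    \<open>?f\<close> gives Wallis' reduction from exponent \<open>Suc k\<close> to
    \<open>k\<close>, the same recurrence as \<open>G_half_Suc\<close>.\<close>
  let ?F = "\<lambda>x::real. - cos x * sin x ^ (2 * k + 1)"
  let ?f = "\<lambda>x::real. 2 * real (Suc k) * ((sin x)\<^sup>2) ^ Suc k - (2 * real k + 1) * ((sin x)\<^sup>2) ^ k"
  have der: "(?F has_real_derivative ?f x) (at x within {0..pi})" for x
  proof -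
    have "(?F has_real_derivative
        sin x * sin x ^ (2 * k + 1) - cos x * (real (2 * k + 1) * sin x ^ (2 * k) * cos x))
        (at x within {0..pi})"
      by (rule derivative_eq_intros refl | simp)+
    moreover have "sin x * sin x ^ (2 * k + 1) - cos x * (real (2 * k + 1) * sin x ^ (2 * k) * cos x)
        = ?f x"
    proof -
      have "cos x * (real (2 * k + 1) * sin x ^ (2 * k) * cos x)
          = real (2 * k + 1) * sin x ^ (2 * k) * (1 - (sin x)\<^sup>2)"
        unfolding cos_squared_eq[symmetric] by (simp add: power2_eq_square)
      moreover have "s * s ^ (2 * k + 1) - real (2 * k + 1) * s ^ (2 * k) * (1 - s\<^sup>2) =
          2 * real (Suc k) * (s\<^sup>2) ^ Suc k - (2 * real k + 1) * (s\<^sup>2) ^ k" for s :: real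
        by (simp add: power_mult algebra_simps power2_eq_square)
      ultimately show ?thesis
        by metis
    qed
    ultimately show ?thesis by simp
  qed
  have "(?f has_integral ?F pi - ?F 0) {0..pi}"
    using der by (intro fundamental_theorem_of_calculus)
      (auto simp: has_real_derivative_iff_has_vector_derivative)
  then have "(?f has_integral 0) {0..pi}"
    by simp
  from has_integral_add[OF this has_integral_mult_right[OF Suc.IH, of "2 * real k + 1"]]
  have "((\<lambda>x. 2 * real (Suc k) * ((sin x)\<^sup>2) ^ Suc k) has_integral
      (2 * real k + 1) * (pi * fps_nth G_half k)) {0..pi}"
    by simp
  from has_integral_mult_right[OF this, of "1 / (2 * real (Suc k))"]
  have "((\<lambda>x. ((sin x)\<^sup>2) ^ Suc k) has_integral
      1 / (2 * real (Suc k)) * ((2 * real k + 1) * (pi * fps_nth G_half k))) {0..pi}"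
    by (simp del: of_nat_Suc power_Suc)
  moreover have "1 / (2 * real (Suc k)) * ((2 * real k + 1) * (pi * fps_nth G_half k)) =
      pi * fps_nth G_half (Suc k)"
    using G_half_Suc[of k] by (simp add: field_simps del: of_nat_Suc)
  ultimately show ?case
    by simp
qed

text \<open>Up to the factor pi, the quadratic form of the Hankel matrix at \<open>w\<close> is the
  integral of the square of \<open>p ((sin x)\<^sup>2)\<close>, where \<open>p\<close> is the
  polynomial with coefficients \<open>w\<close>. A kernel vector makes this integral 0, so
  \<open>p\<close> has infinitely many roots.\<close>

lemma G_half_hankel_nonsingular:
  assumes ker: "\<And>i. i \<le> t \<Longrightarrow> (\<Sum>j\<le>t. fps_nth G_half (i + j) * w j) = 0"
    and "j \<le> t"
  shows "w j = 0"
proof -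
  define p where "p = (\<lambda>y::real. \<Sum>i\<le>t. w i * y ^ i)"
  have sq: "(p y)\<^sup>2 = (\<Sum>i\<le>t. \<Sum>j\<le>t. w i * w j * y ^ (i + j))" for y
    unfolding p_def power2_eq_square sum_product by (simp add: power_add mult_ac)
  have "((\<lambda>x. (p ((sin x)\<^sup>2))\<^sup>2) has_integral
      (\<Sum>i\<le>t. \<Sum>j\<le>t. w i * w j * (pi * fps_nth G_half (i + j)))) {0..pi}"
    unfolding sq
    by (intro has_integral_sum has_integral_mult_right has_integral_sin_power_G_half) auto
  also have "(\<Sum>i\<le>t. \<Sum>j\<le>t. w i * w j * (pi * fps_nth G_half (i + j))) =
      (\<Sum>i\<le>t. pi * w i * (\<Sum>j\<le>t. fps_nth G_half (i + j) * w j))"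
    by (simp add: sum_distrib_left mult_ac)
  also have "\<dots> = 0"
    using ker by simp
  finally have int0: "((\<lambda>x. (p ((sin x)\<^sup>2))\<^sup>2) has_integral 0) {0..pi}" .
  have "continuous_on {0..pi} (\<lambda>x. (p ((sin x)\<^sup>2))\<^sup>2)"
    unfolding p_def by (intro continuous_intros)
  then have zero: "p ((sin x)\<^sup>2) = 0" if "x \<in> {0..pi}" for x
    using has_integral_0_cbox_imp_0[of 0 pi "\<lambda>x. (p ((sin x)\<^sup>2))\<^sup>2" x] int0 that pi_gt_zero
    by (simp add: not_le)
  \<comment> \<open>The squared sine maps \<open>{0..pi}\<close> onto \<open>{0..1}\<close>; a
    preimage of \<open>y\<close> is \<open>arcsin (sqrt y)\<close>.\<close>
  have "{0..1} \<subseteq> {y. p y = 0}"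
  proof
    fix y :: real assume y: "y \<in> {0..1}"
    then have "0 \<le> arcsin (sqrt y)" "arcsin (sqrt y) \<le> pi / 2"
      using arcsin_le_arcsin[of 0 "sqrt y"] arcsin_ubound[of "sqrt y"]
        order_trans[of "-1" 0 "sqrt y"] by simp_all
    then have "arcsin (sqrt y) \<in> {0..pi}"
      using pi_gt_zero by simp
    moreover have "(sin (arcsin (sqrt y)))\<^sup>2 = y"
      using y order_trans[of "-1" 0 "sqrt y"] by simp
    ultimately show "y \<in> {y. p y = 0}"
      using zero by force
  qed
  then have "infinite {y. p y = 0}"
    by (rule infinite_super) (rule infinite_Icc[OF zero_less_one])
  with polyfun_finite_roots[of w t] \<open>j \<le> t\<close> show ?thesis
    unfolding p_def by auto
qed

lemma mat_apply_toeplitz: "mat_apply (toeplitz a) z i = (\<Sum>j\<le>i. a (i - j) * z j)"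
proof -
  have "mat_apply (toeplitz a) z i = (\<Sum>j\<le>i. toeplitz a i j * z j)"
    unfolding mat_apply_def by (intro suminf_finite) (auto simp: toeplitz_def)
  then show ?thesis
    by (simp add: toeplitz_def)
qed

text \<open>Points of \<open>Euclidean_space (Suc t)\<close> are prefixes already continued with
  zeros. Reversing the prefix turns the index difference of the Toeplitz matrix into the sum
  \<open>i + j\<close> of a Hankel matrix.\<close>

lemma mat_apply_toeplitz_prefix:
  assumes "z \<in> topspace (Euclidean_space (Suc t))"
  shows "mat_apply (toeplitz a) z (t + i) = (\<Sum>j\<le>t. a (i + j) * z (t - j))"
proof -
  have "mat_apply (toeplitz a) z (t + i) = (\<Sum>j\<le>t. a (t + i - j) * z j)"
    unfolding mat_apply_toeplitz using assms
    by (intro sum.mono_neutral_right) (auto simp: topspace_Euclidean_space)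
  also have "\<dots> = (\<Sum>j\<le>t. a (i + j) * z (t - j))"
    by (rule sum.reindex_bij_witness[of _ "\<lambda>j. t - j" "\<lambda>j. t - j"])
      (auto simp: add.commute)
  finally show ?thesis .
qed

lemma stream_state_continue:
  assumes "stream_state u z t = stream_state u z' t" "\<And>i. t < i \<Longrightarrow> z i = z' i"
  shows "stream_state u z (t + i) = stream_state u z' (t + i)"
  using assms by (induction i) auto

lemma streaming_G_half_buffer_ge:
  assumes alg: "streaming_algorithm \<beta> u m"
    and comp: "computes_up_to u m (toeplitz (fps_nth G_half)) (2 * t)"
  shows "t + 1 \<le> \<beta> (int t)"
proof (rule ccontr)
  let ?E = "topspace (Euclidean_space (Suc t))"
  assume "\<not> t + 1 \<le> \<beta> (int t)"
  then have "\<not> inj_on (\<lambda>z. stream_state u z t) ?E"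
    using alg by (intro no_continuous_injection_Euclidean_space[of "\<beta> (int t)"])
      (auto simp: streaming_algorithm_def)
  then obtain z z' where z: "z \<in> ?E" "z' \<in> ?E" "z \<noteq> z'"
    and eq: "stream_state u z t = stream_state u z' t"
    unfolding inj_on_def by blast
  have "(\<Sum>j\<le>t. fps_nth G_half (i + j) * (z (t - j) - z' (t - j))) = 0" if "i \<le> t" for i
  proof -
    have "stream_state u z (t + i) = stream_state u z' (t + i)"
      using eq z(1,2) by (intro stream_state_continue) (auto simp: topspace_Euclidean_space)
    \<comment> \<open>Correctness up to time \<open>2 * t\<close> lets \<open>i\<close> run through
      all of 0 to \<open>t\<close>, which supplies every row of the square Hankel matrix.\<close>
    moreover have "t + i \<le> 2 * t"
      using that by simp
    ultimately have "mat_apply (toeplitz (fps_nth G_half)) z (t + i) =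
        mat_apply (toeplitz (fps_nth G_half)) z' (t + i)"
      using comp unfolding computes_up_to_def by metis
    then show ?thesis
      unfolding mat_apply_toeplitz_prefix[OF z(1)] mat_apply_toeplitz_prefix[OF z(2)]
      by (simp add: right_diff_distrib sum_subtractf)
  qed
  from G_half_hankel_nonsingular[of t "\<lambda>j. z (t - j) - z' (t - j)", OF this]
  have "z (t - j) = z' (t - j)" if "j \<le> t" for j
    using that by simp
  then have "z j = z' j" if "j \<le> t" for j
    using that by (metis diff_diff_cancel diff_le_self)
  moreover have "z j = z' j" if "\<not> j \<le> t" for j
    using that z(1,2) by (auto simp: topspace_Euclidean_space)
  ultimately show False
    using \<open>z \<noteq> z'\<close> by blast
qed

lemma streaming_algorithm_store_input:
  "\<exists>\<beta> u m. streaming_algorithm \<beta> u m \<and> computes_up_to u m (toeplitz a) \<tau> \<and>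
     Max (\<beta> ` {-1..int t}) \<le> t + 1"
proof -
  \<comment> \<open>The maximum with 1 matters at time -1, where one cell is prescribed. The first
    update overwrites that cell, so \<open>t + 1\<close> cells suffice at time
    \<open>t\<close>.\<close>
  define \<beta> :: "int \<Rightarrow> nat" where "\<beta> k = max 1 (nat (k + 1))" for k
  define u :: "nat \<Rightarrow> (nat \<Rightarrow> real) \<Rightarrow> real \<Rightarrow> nat \<Rightarrow> real" where "u t s x = s(t := x)" for t s x
  \<comment> \<open>The stored prefix is padded with zeros, and row \<open>t\<close> of a
    lower-triangular matrix reads only entries up to \<open>t\<close>, so the output is
    exact.\<close>
  define m where "m t s = mat_apply (toeplitz a) s t" for t s
  have state: "stream_state u z t = (\<lambda>i. if i < Suc t then z i else 0)" for z t
    by (induction t) (auto simp: u_def fun_eq_iff less_Suc_eq)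
  have "streaming_algorithm \<beta> u m"
    unfolding streaming_algorithm_def
  proof (intro conjI allI ballI)
    show "\<beta> (- 1) = 1"
      by (simp add: \<beta>_def)
    show "u t s x \<in> topspace (Euclidean_space (\<beta> (int t)))"
      if "s \<in> topspace (Euclidean_space (\<beta> (int t - 1)))" for t s x
      using that by (auto simp: topspace_Euclidean_space \<beta>_def u_def nat_add_distrib)
    show "continuous_map (Euclidean_space (Suc t)) (Euclidean_space (\<beta> (int t)))
        (\<lambda>z. stream_state u z t)" for t
    proof -
      have "\<beta> (int t) = Suc t"
        by (simp add: \<beta>_def nat_add_distrib)
      moreover have "continuous_map (Euclidean_space (Suc t)) euclideanreal (\<lambda>z. z i)" for i
        unfolding Euclidean_space_def
        by (intro continuous_map_from_subtopology continuous_map_product_projection) auto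
      ultimately show ?thesis
        by (simp only: state continuous_map_componentwise_Euclidean_space) blast
    qed
  qed
  moreover have "computes_up_to u m (toeplitz a) \<tau>"
    by (simp add: computes_up_to_def m_def state mat_apply_toeplitz)
  moreover have "Max (\<beta> ` {-1..int t}) \<le> t + 1"
    by (subst Max_le_iff) (auto simp: \<beta>_def)
  ultimately show ?thesis
    by blast
qed

theorem theorem1p9:
  fixes t :: nat
  shows "space_gf G_half t (2 * t) = enat (t + 1)"
proof (rule antisym)
  show "space_gf G_half t (2 * t) \<le> enat (t + 1)"
    unfolding space_gf_def space_mat_def
    by (intro Inf_lower CollectI exI[of _ "t + 1"] conjI refl streaming_algorithm_store_input)
  show "enat (t + 1) \<le> space_gf G_half t (2 * t)"
    unfolding space_gf_def space_mat_def
  proof (rule Inf_greatest)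
    fix x
    assume "x \<in> {enat b | b. \<exists>\<beta> u m. streaming_algorithm \<beta> u m \<and>
      computes_up_to u m (toeplitz (fps_nth G_half)) (2 * t) \<and> Max (\<beta> ` {-1..int t}) \<le> b}"
    then obtain b \<beta> u m where x: "x = enat b" and b: "Max (\<beta> ` {-1..int t}) \<le> b"
      and alg: "streaming_algorithm \<beta> u m"
      and comp: "computes_up_to u m (toeplitz (fps_nth G_half)) (2 * t)"
      by (elim CollectE exE conjE)
    have "t + 1 \<le> \<beta> (int t)"
      using alg comp by (rule streaming_G_half_buffer_ge)
    also have "\<dots> \<le> Max (\<beta> ` {-1..int t})"
      by (intro Max_ge) auto
    also note b
    finally show "enat (t + 1) \<le> x"
      unfolding x by simp
  qed
qed

end
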